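(* Let $p$ be an odd prime, $n\ge 2$, and let $f:\mathbb{F}_{p^n}\to\mathbb{F}_p$ be a quadratic near-bent function. Fix a basis of $\mathbb{F}_{p^n}$ over $\mathbb{F}_p$ and write $f(\mathbf{x})=\mathbf{x}^TA\mathbf{x}$ with $A$ a symmetric $n\times n$ matrix over $\mathbb{F}_p$; let $C$ be a nonsingular matrix over $\mathbb{F}_p$ with $C^TAC=D$ diagonal. Then $D$ has exactly $n-1$ nonzero diagonal entries $d_1,\ldots,d_{n-1}$, and, setting $\Delta=\prod_{i=1}^{n-1}d_i$, there is a function $J:\mathrm{supp}(\widehat f)\to\mathbb{F}_p$ such that for every $b\in\mathbb{F}_{p^n}$ either $\widehat f(b)=0$ or $\widehat f(b)=\kappa\, p^{\frac{n+1}{2}}\epsilon_p^{J(b)}$, where $\kappa=\eta(\Delta)$ if $p\equiv1\pmod 4$; $\kappa=(-1)^{\frac{n-2}{2}}\eta(\Delta)\,i$ if $p\equiv 3\pmod 4$ and $n$ is even; $\kappa=(-1)^{\frac{n-1}{2}}\eta(\Delta)$ if $p\equiv3\pmod4$ and $n$ is odd.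
   Context: $\epsilon_p=e^{2\pi i/p}$, $\mathrm{Tr}_n$ the absolute trace, $\widehat{f}(b)=\sum_{x\in\mathbb{F}_{p^n}}\epsilon_p^{f(x)-\mathrm{Tr}_n(bx)}$, $\mathrm{supp}(\widehat f)=\{b:\widehat f(b)\ne 0\}$. Near-bent: $|\widehat{f}(b)|^2\in\{0,p^{n+1}\}$ for all $b$. Quadratic function: $f(x)=\mathrm{Tr}_n(\sum_{i=0}^la_ix^{p^i+1})$, $a_i\in\mathbb{F}_{p^n}$; identifying $x=\sum x_i\alpha_i$ with $\mathbf{x}=(x_1,\ldots,x_n)$ for the fixed basis $\{\alpha_i\}$, $f$ becomes a quadratic form over $\mathbb{F}_p$. $\eta$ denotes the quadratic character of $\mathbb{F}_p$. *)

theory Defs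
  imports Complex_Main "HOL-Number_Theory.Residues" "Jordan_Normal_Form.Determinant"
begin

text \<open>The field F_(p^n) is modelled by a finite field type 'a with CARD('a) = p^n
  (p prime); F_p is its prime subfield, the set of images of 0,...,p-1.\<close>

definition Fp :: "nat \<Rightarrow> 'a::field set" where
  "Fp p = of_nat ` {..<p}"

definition Fp_rep :: "nat \<Rightarrow> 'a::field \<Rightarrow> nat" where
  "Fp_rep p y = (THE k. k < p \<and> of_nat k = y)"

definition Tr :: "nat \<Rightarrow> nat \<Rightarrow> 'a::field \<Rightarrow> 'a" where
  "Tr p n x = (\<Sum>i<n. x ^ (p ^ i))"

definition epsp :: "nat \<Rightarrow> 'a::field \<Rightarrow> complex" where
  "epsp p y = cis (2 * pi * real (Fp_rep p y) / real p)"

definition walsh :: "nat \<Rightarrow> nat \<Rightarrow> ('a::{field,finite} \<Rightarrow> 'a) \<Rightarrow> 'a \<Rightarrow> complex" where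
  "walsh p n f b = (\<Sum>x\<in>UNIV. epsp p (f x - Tr p n (b * x)))"

definition supp_walsh :: "nat \<Rightarrow> nat \<Rightarrow> ('a::{field,finite} \<Rightarrow> 'a) \<Rightarrow> 'a set" where
  "supp_walsh p n f = {b. walsh p n f b \<noteq> 0}"

definition near_bent :: "nat \<Rightarrow> nat \<Rightarrow> ('a::{field,finite} \<Rightarrow> 'a) \<Rightarrow> bool" where
  "near_bent p n f \<longleftrightarrow> (\<forall>b. (cmod (walsh p n f b))^2 \<in> {0, real p ^ (n+1)})"

definition quadratic_fun :: "nat \<Rightarrow> nat \<Rightarrow> ('a::{field,finite} \<Rightarrow> 'a) \<Rightarrow> bool" where
  "quadratic_fun p n f \<longleftrightarrow>
     (\<exists>l a. \<forall>x. f x = Tr p n (\<Sum>i\<le>l. a i * x ^ (p ^ i + 1)))"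

definition is_Fp_basis :: "nat \<Rightarrow> nat \<Rightarrow> (nat \<Rightarrow> 'a::field) \<Rightarrow> bool" where
  "is_Fp_basis p n \<alpha> \<longleftrightarrow>
     (\<forall>x. \<exists>!c. (\<forall>i<n. c i \<in> Fp p) \<and> (\<forall>i\<ge>n. c i = 0) \<and> x = (\<Sum>i<n. c i * \<alpha> i))"

definition eta :: "nat \<Rightarrow> 'a::field \<Rightarrow> int" where
  "eta p y = Legendre (int (Fp_rep p y)) (int p)"

definition mat_over_Fp :: "nat \<Rightarrow> 'a::field mat \<Rightarrow> bool" where
  "mat_over_Fp p M \<longleftrightarrow> (\<forall>i<dim_row M. \<forall>j<dim_col M. M $$ (i,j) \<in> Fp p)"

end

theory Submission
  imports Defs "HOL-Number_Theory.Euler_Criterion"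
begin

text \<open>
  In the coordinates given by the basis and C the Walsh transform factors into
  one-dimensional sums over the prime field. A zero diagonal entry contributes p or 0; a nonzero
  entry d contributes, after completing the square, the character value \<open>\<eta>(d)\<close> times a root of
  unity times the quadratic Gauss sum G. At b = 0 no factor vanishes, so the near-bent condition
  there forces exactly one zero diagonal entry, and the constant \<open>\<kappa>\<close> is read off from \<open>G ^ (n - 1)\<close>.

  The sign of G is determined by Gauss's original argument. The alternating sum of the Gaussian
  binomials of an even number 2m equals the product of the \<open>1 - q ^ (2k+1)\<close> for k < m. At a
  primitive p-th root of unity with p = 2m + 1 the sum becomes G up to a root of unity, and the
  product becomes a product of sines whose signs are visible.
\<close>

section \<open>The sign of the quadratic Gauss sum\<close>

text \<open>Given by the Pascal rule instead of a quotient, so that Gaussian binomials make sense in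
  every commutative ring and can be evaluated at roots of unity.\<close>

fun qbinomial :: "'a::comm_ring_1 \<Rightarrow> nat \<Rightarrow> nat \<Rightarrow> 'a" where
  "qbinomial q n 0 = 1"
| "qbinomial q 0 (Suc k) = 0"
| "qbinomial q (Suc n) (Suc k) = qbinomial q n k + q ^ Suc k * qbinomial q n (Suc k)"

lemma qbinomial_eq_0: "n < k \<Longrightarrow> qbinomial q n k = 0"
  by (induction q n k rule: qbinomial.induct) auto

text \<open>Pascal's rule and the neighbour relation in row \<open>n\<close> combine to absorption
  from row \<open>n + 1\<close> into row \<open>n\<close>. The relation is a hypothesis because its
  own inductive proof calls on this step.\<close>

lemma qbinomial_absorption_aux:
  assumes "(1 - q ^ Suc k) * qbinomial q n (Suc k) = (1 - q ^ (n - k)) * qbinomial q n k" "k \<le> n"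
  shows   "(1 - q ^ Suc k) * qbinomial q (Suc n) (Suc k) = (1 - q ^ Suc n) * qbinomial q n k"
proof -
  have "q ^ Suc k * q ^ (n - k) = q ^ Suc n"
    using assms(2) unfolding power_add[symmetric] by simp
  moreover have "(1 - q ^ Suc k) * qbinomial q (Suc n) (Suc k) =
      (1 - q ^ Suc k) * qbinomial q n k + q ^ Suc k * ((1 - q ^ Suc k) * qbinomial q n (Suc k))"
    by (simp add: algebra_simps)
  ultimately show ?thesis
    unfolding assms(1) by (simp add: algebra_simps)
qed

text \<open>The ratio of neighbours in a row, cross-multiplied to avoid division. For
  \<open>0 < k \<le> n\<close> both sides in row \<open>Suc n\<close> reduce to
  \<open>(1 - q ^ Suc n) * qbinomial q n k\<close>: the left by absorption, the right by Pascal's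
  rule and the induction hypothesis at \<open>k - 1\<close>.\<close>

lemma qbinomial_Suc_right:
  "k \<le> n \<Longrightarrow> (1 - q ^ Suc k) * qbinomial q n (Suc k) = (1 - q ^ (n - k)) * qbinomial q n k"
proof (induction n arbitrary: k)
  case 0
  then show ?case by simp
next
  case (Suc n)
  show ?case
  proof (cases k)
    case 0
    then show ?thesis
      using qbinomial_absorption_aux[OF Suc.IH[of 0]] by simp
  next
    case k: (Suc j)
    show ?thesis
    proof (cases "k \<le> n")
      case True
      have pow: "q ^ k * q ^ (n - j) = q ^ Suc n"
        using Suc.prems k unfolding power_add[symmetric] by simp
      have "(1 - q ^ (Suc n - k)) * qbinomial q (Suc n) k =
            (1 - q ^ (n - j)) * qbinomial q n j + (q ^ k - q ^ k * q ^ (n - j)) * qbinomial q n k"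
        using k by (simp add: algebra_simps)
      also have "\<dots> = (1 - q ^ Suc n) * qbinomial q n k"
        using Suc.IH[of j] Suc.prems k unfolding pow by (simp add: algebra_simps)
      also have "\<dots> = (1 - q ^ Suc k) * qbinomial q (Suc n) (Suc k)"
        using qbinomial_absorption_aux[OF Suc.IH[OF True] True] by simp
      finally show ?thesis by simp
    next
      case False
      \<comment> \<open>Here the left binomial lies beyond the row and the right factor is
        \<open>1 - q ^ 0\<close>, so both sides vanish.\<close>
      then have "k = Suc n" using Suc.prems by simp
      then show ?thesis by (simp add: qbinomial_eq_0)
    qed
  qed
qed

lemma qbinomial_absorption:
  "k \<le> n \<Longrightarrow> (1 - q ^ Suc k) * qbinomial q (Suc n) (Suc k) = (1 - q ^ Suc n) * qbinomial q n k"
  by (intro qbinomial_absorption_aux qbinomial_Suc_right)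

text \<open>Pascal's rule writes row \<open>n + 2\<close> as two signed sums over row
  \<open>n + 1\<close>. An index shift merges them into multiples of \<open>1 - q ^ Suc k\<close>,
  which absorption lowers to row \<open>n\<close> with a factor independent of
  \<open>k\<close>.\<close>

lemma qbinomial_alternating_sum_Suc_Suc:
  "(\<Sum>k\<le>Suc (Suc n). (-1) ^ k * qbinomial q (Suc (Suc n)) k) =
   (1 - q ^ Suc n) * (\<Sum>k\<le>n. (-1) ^ k * qbinomial q n k)"
proof -
  let ?B = "qbinomial q (Suc n)"
  have split: "(\<Sum>k\<le>Suc n. (-1) ^ k * ?B k) = 1 - (\<Sum>k\<le>n. (-1) ^ k * ?B (Suc k))"
    unfolding sum.atMost_Suc_shift by (simp add: sum_negf)
  have "(\<Sum>k\<le>Suc (Suc n). (-1) ^ k * qbinomial q (Suc (Suc n)) k) =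
        1 - (\<Sum>k\<le>Suc n. (-1) ^ k * (?B k + q ^ Suc k * ?B (Suc k)))"
    unfolding sum.atMost_Suc_shift[of _ "Suc n"] by (simp add: sum_negf)
  \<comment> \<open>The second sum loses its term at \<open>k = Suc n\<close>, whose binomial lies
    beyond the row.\<close>
  also have "\<dots> = 1 - (\<Sum>k\<le>Suc n. (-1) ^ k * ?B k) - (\<Sum>k\<le>n. (-1) ^ k * (q ^ Suc k * ?B (Suc k)))"
    by (simp only: distrib_left sum.distrib) (simp add: qbinomial_eq_0 del: qbinomial.simps)
  also have "\<dots> = (\<Sum>k\<le>n. (-1) ^ k * ((1 - q ^ Suc k) * ?B (Suc k)))"
    unfolding split by (simp add: algebra_simps sum_subtractf sum.distrib del: qbinomial.simps)
  also have "\<dots> = (\<Sum>k\<le>n. (-1) ^ k * ((1 - q ^ Suc n) * qbinomial q n k))"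
    by (intro sum.cong refl arg_cong2[where f = "(*)"] qbinomial_absorption) auto
  finally show ?thesis
    by (simp add: sum_distrib_left mult_ac)
qed

lemma qbinomial_alternating_sum:
  "(\<Sum>k\<le>2*m. (-1) ^ k * qbinomial q (2*m) k) = (\<Prod>k<m. 1 - q ^ (2*k+1))"
proof (induction m)
  case (Suc m)
  have eq: "2 * Suc m = Suc (Suc (2*m))" by simp
  show ?case
    unfolding eq qbinomial_alternating_sum_Suc_Suc Suc.IH by simp
qed auto

section \<open>Additive characters on the integers and the modulus of the Gauss sum\<close>

text \<open>Defined on all integers rather than on residues, so that negative exponents and
  differences of squares need no reduction modulo \<open>p\<close>.\<close>

definition unity_char :: "nat \<Rightarrow> int \<Rightarrow> complex" where
  "unity_char p k = cis (2 * pi * of_int k / of_nat p)"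

lemma unity_char_0 [simp]: "unity_char p 0 = 1"
  by (simp add: unity_char_def)

lemma unity_char_add: "unity_char p (a + b) = unity_char p a * unity_char p b"
  by (simp add: unity_char_def cis_mult add_divide_distrib ring_distribs)

lemma cnj_unity_char: "cnj (unity_char p a) = unity_char p (-a)"
  by (simp add: unity_char_def cis_cnj)

lemma unity_char_power: "unity_char p a ^ k = unity_char p (int k * a)"
  by (induction k) (auto simp: unity_char_add ring_distribs)

lemma unity_char_eq_1_iff:
  assumes "p > 0"
  shows   "unity_char p a = 1 \<longleftrightarrow> int p dvd a"
proof
  assume "int p dvd a"
  then obtain c where "a = int p * c" by blast
  then show "unity_char p a = 1"
    using assms cis_multiple_2pi[of "of_int c"] by (simp add: unity_char_def mult.assoc)
next
  assume "unity_char p a = 1"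
  then have "cos (2 * pi * of_int a / of_nat p) = 1"
    by (simp add: unity_char_def complex_eq_iff)
  then obtain m :: int where "2 * pi * of_int a / of_nat p = of_int m * (2 * pi)"
    by (auto simp: cos_one_2pi_int)
  then have "real_of_int a = of_int (m * int p)"
    using assms by (simp add: field_simps)
  then show "int p dvd a" 
    by (metis dvd_triv_right of_int_eq_iff)
qed

lemma unity_char_cong:
  assumes "[a = b] (mod int p)" "p > 0"
  shows   "unity_char p a = unity_char p b"
proof -
  have "unity_char p (a - b) = 1"
    using assms by (simp add: unity_char_eq_1_iff cong_iff_dvd_diff)
  then show ?thesis
    using unity_char_add[of p "a - b" b] by simp
qed

lemma sum_unity_char:
  assumes "p > 0"
  shows   "(\<Sum>y<p. unity_char p (c * int y)) = (if int p dvd c then of_nat p else 0)"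
proof (cases "int p dvd c")
  case True
  then have "unity_char p (c * int y) = 1" for y
    using assms by (simp add: unity_char_eq_1_iff)
  then show ?thesis using True by simp
next
  case False
  define z where "z = unity_char p c"
  have "z \<noteq> 1" "z ^ p = 1"
    using False assms by (auto simp: z_def unity_char_eq_1_iff unity_char_power)
  moreover have "(\<Sum>y<p. unity_char p (c * int y)) = (\<Sum>y<p. z ^ y)"
    by (simp add: z_def unity_char_power mult.commute)
  ultimately show ?thesis
    using False by (simp add: geometric_sum)
qed

text \<open>Each unit shift of the window drops \<open>g (int h)\<close> and gains
  \<open>g (int h + int p)\<close>, which agree by periodicity.\<close>

lemma sum_shift_periodic:
  fixes g :: "int \<Rightarrow> 'a::ab_group_add"
  assumes "\<And>x. g (x + int p) = g x"
  shows   "(\<Sum>x<p. g (int x + int h)) = (\<Sum>x<p. g (int x))"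
proof (induction h)
  case (Suc h)
  have "(\<Sum>x<p. g (int x + int (Suc h))) = (\<Sum>x<p. g (int (Suc x) + int h))"
    by (simp add: add_ac)
  also have "\<dots> = (\<Sum>x<Suc p. g (int x + int h)) - g (int h)"
    unfolding sum.lessThan_Suc_shift[of _ p] by simp
  also have "\<dots> = (\<Sum>x<p. g (int x + int h))"
    using assms[of "int h"] by (simp add: add.commute)
  finally show ?case using Suc.IH by simp
qed auto

definition gauss_sum :: "nat \<Rightarrow> complex" where
  "gauss_sum p = (\<Sum>x<p. unity_char p (int x ^ 2))"

text \<open>In the product of the sum with its conjugate, replacing \<open>x\<close> by
  \<open>x + y\<close> turns the exponent into \<open>x^2 + 2xy\<close>. The sum over
  \<open>y\<close> then vanishes unless \<open>p\<close> divides \<open>2x\<close>, which for odd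
  \<open>p\<close> leaves only \<open>x = 0\<close>.\<close>

lemma norm_gauss_sum:
  assumes "odd p"
  shows   "norm (gauss_sum p) ^ 2 = real p"
proof -
  have p: "p > 0" using assms by (auto intro: Nat.gr0I)
  have "complex_of_real (norm (gauss_sum p) ^ 2) = gauss_sum p * cnj (gauss_sum p)"
    by (simp flip: complex_norm_square)
  also have "\<dots> = (\<Sum>y<p. \<Sum>x<p. unity_char p (int x ^ 2 - int y ^ 2))"
    unfolding gauss_sum_def cnj_sum sum_product
    by (subst sum.swap) (simp add: cnj_unity_char flip: unity_char_add)
  also have "\<dots> = (\<Sum>y<p. \<Sum>x<p. unity_char p ((int x + int y) ^ 2 - int y ^ 2))"
  proof (rule sum.cong)
    fix y
    have "unity_char p ((x + int p) ^ 2 - int y ^ 2) = unity_char p (x ^ 2 - int y ^ 2)" for x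
      by (rule unity_char_cong[OF _ p])
         (simp add: cong_iff_dvd_diff power2_eq_square algebra_simps)
    from sum_shift_periodic[where g = "\<lambda>x. unity_char p (x ^ 2 - int y ^ 2)", OF this, of y]
    show "(\<Sum>x<p. unity_char p (int x ^ 2 - int y ^ 2)) =
          (\<Sum>x<p. unity_char p ((int x + int y) ^ 2 - int y ^ 2))" by (rule sym)
  qed auto
  also have "\<dots> = (\<Sum>x<p. unity_char p (int x ^ 2) * (\<Sum>y<p. unity_char p (2 * int x * int y)))"
    by (subst sum.swap)
       (simp add: sum_distrib_left power2_eq_square algebra_simps flip: unity_char_add)
  also have "\<dots> = (\<Sum>x<p. if x = 0 then of_nat p else 0)"
  proof (intro sum.cong refl)
    fix x assume "x \<in> {..<p}"
    moreover have "int p dvd 2 * int x \<longleftrightarrow> p dvd x"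
      using assms by (metis coprime_right_2_iff_odd coprime_dvd_mult_right_iff of_nat_dvd_iff of_nat_mult of_nat_numeral)
    ultimately have "int p dvd 2 * int x \<longleftrightarrow> x = 0"
      by (auto dest: dvd_imp_le)
    then show "unity_char p (int x ^ 2) * (\<Sum>y<p. unity_char p (2 * int x * int y)) =
               (if x = 0 then of_nat p else 0)"
      by (simp add: sum_unity_char[OF p])
  qed
  also have "\<dots> = of_real (real p)" using p by simp
  finally show ?thesis by (simp only: of_real_eq_iff)
qed

section \<open>Product formula and sign of the Gauss sum\<close>

text \<open>For this \<open>q\<close> the exponent \<open>p - 1 - k\<close> gives the inverse of
  \<open>q ^ Suc k\<close>, so the ratio of neighbours has the form
  \<open>(1 - z) / (1 - 1/z) = -z\<close>. Multiplying the ratios adds up the exponents 2, 4, ...,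
  2k.\<close>

lemma qbinomial_unity_char:
  assumes "odd p" "k < p"
  shows   "qbinomial (unity_char p (-2)) (p - 1) k = (-1) ^ k * unity_char p (int k * (int k + 1))"
  using assms(2)
proof (induction k)
  case (Suc k)
  have p: "p > 0" using assms by (auto intro: Nat.gr0I)
  let ?q = "unity_char p (-2)" and ?B = "qbinomial (unity_char p (-2)) (p - 1)"
  let ?z = "unity_char p (2 * int (Suc k))"
  have zq: "?z * ?q ^ Suc k = 1"
    unfolding unity_char_power unity_char_add[symmetric] by simp
  \<comment> \<open>Cancelling \<open>1 - q ^ Suc k\<close> requires it to be nonzero, which follows
    from \<open>p\<close> being odd and \<open>0 < Suc k < p\<close>.\<close>
  have "int p dvd (- 2) * int (Suc k) \<longleftrightarrow> p dvd Suc k"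
    using assms by (metis coprime_right_2_iff_odd coprime_dvd_mult_right_iff of_nat_dvd_iff of_nat_mult of_nat_numeral dvd_minus_iff mult_minus_left)
  then have "?q ^ Suc k \<noteq> 1"
    using Suc.prems p unfolding unity_char_power
    by (subst unity_char_eq_1_iff) (auto dest: dvd_imp_le simp: mult.commute)
  moreover have "?q ^ (p - 1 - k) = ?z"
    unfolding unity_char_power
    by (rule unity_char_cong[OF _ p]) (use Suc.prems in \<open>simp add: cong_iff_dvd_diff of_nat_diff algebra_simps\<close>)
  then have "(1 - ?q ^ Suc k) * ?B (Suc k) = (1 - ?z) * ?B k"
    using qbinomial_Suc_right[of k "p - 1" ?q] Suc.prems by simp
  moreover have "1 - ?z = (1 - ?q ^ Suc k) * (- ?z)"
    using zq by (simp add: algebra_simps)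
  ultimately have "?B (Suc k) = - ?z * ?B k"
    by (metis (no_types, lifting) eq_iff_diff_eq_0 mult.assoc mult_left_cancel)
  also have "\<dots> = (-1) ^ Suc k * (?z * unity_char p (int k * (int k + 1)))"
    using Suc by simp
  also have "?z * unity_char p (int k * (int k + 1)) = unity_char p (int (Suc k) * (int (Suc k) + 1))"
    unfolding unity_char_add[symmetric] by (simp add: algebra_simps)
  finally show ?case .
qed auto

lemma gauss_sum_eq_prod_sin:
  assumes "p = 2 * m + 1"
  shows   "gauss_sum p = \<i> ^ m * of_real (\<Prod>k<m. 2 * sin (2 * pi * (2 * real k + 1) / real p))"
proof -
  have p: "p > 0" "odd p" using assms by auto
  \<comment> \<open>Modulo \<open>p = 2m + 1\<close> the number \<open>m + 1\<close> is the inverse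
    of 2, so this shift completes the square of \<open>k (k + 1)\<close>.\<close>
  have "gauss_sum p = (\<Sum>k<p. unity_char p ((int k + int (Suc m)) ^ 2))"
    unfolding gauss_sum_def
    by (rule sum_shift_periodic[symmetric], rule unity_char_cong[OF _ p(1)])
       (auto simp: cong_iff_dvd_diff power2_eq_square algebra_simps)
  also have "\<dots> = (\<Sum>k<p. unity_char p (int m ^ 2) * unity_char p (int k * (int k + 1)))"
    unfolding unity_char_add[symmetric]
  proof (intro sum.cong refl unity_char_cong[OF _ p(1)])
    fix k
    have "(int k + int (Suc m)) ^ 2 - (int m ^ 2 + int k * (int k + 1)) = int p * (int k + 1)"
      unfolding assms by (simp add: power2_eq_square algebra_simps)
    then show "[(int k + int (Suc m)) ^ 2 = int m ^ 2 + int k * (int k + 1)] (mod int p)"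
      by (simp add: cong_iff_dvd_diff)
  qed
  \<comment> \<open>The alternating sign cancels the sign of the binomial at the root of unity, and
    \<open>2 * m\<close> is \<open>p - 1\<close>.\<close>
  also have "\<dots> = unity_char p (int m ^ 2) * (\<Sum>k\<le>2*m. (-1) ^ k * qbinomial (unity_char p (-2)) (2*m) k)"
    unfolding sum_distrib_left
  proof (rule sum.cong)
    fix k assume "k \<in> {..2*m}"
    then have "(-1) ^ k * qbinomial (unity_char p (-2)) (2*m) k = unity_char p (int k * (int k + 1))"
      using qbinomial_unity_char[of p k] assms p by (simp flip: power_add mult.assoc)
    then show "unity_char p (int m ^ 2) * unity_char p (int k * (int k + 1)) =
      unity_char p (int m ^ 2) * ((-1) ^ k * qbinomial (unity_char p (-2)) (2*m) k)" by simp
  qed (use assms in auto)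
  also have "\<dots> = unity_char p (int m ^ 2) * (\<Prod>k<m. 1 - unity_char p (-2) ^ (2*k+1))"
    by (simp only: qbinomial_alternating_sum)
  \<comment> \<open>As \<open>m^2\<close> is the sum of the first \<open>m\<close> odd numbers, the
    prefactor can be distributed over the \<open>m\<close> factors. Each then becomes a number minus
    its conjugate, that is, \<open>2i\<close> times a sine.\<close>
  also have "unity_char p (int m ^ 2) = (\<Prod>k<m. unity_char p (2 * int k + 1))"
  proof (induction m)
    case (Suc m)
    have "int (Suc m) ^ 2 = int m ^ 2 + (2 * int m + 1)"
      by (simp add: power2_eq_square algebra_simps)
    then show ?case using Suc by (simp add: unity_char_add)
  qed auto
  also have "\<dots> * (\<Prod>k<m. 1 - unity_char p (-2) ^ (2*k+1)) =
             (\<Prod>k<m. \<i> * of_real (2 * sin (2 * pi * (2 * real k + 1) / real p)))"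
    unfolding prod.distrib[symmetric]
  proof (intro prod.cong refl)
    fix k
    have "unity_char p (2 * int k + 1) * (1 - unity_char p (-2) ^ (2*k+1)) =
          unity_char p (2 * int k + 1) - unity_char p (2 * int k + 1 + int (2*k+1) * (-2))"
      by (simp only: unity_char_power unity_char_add right_diff_distrib mult_1_right)
    also have "2 * int k + 1 + int (2*k+1) * (-2) = - (2 * int k + 1)" by simp
    also have "unity_char p (2 * int k + 1) - unity_char p (- (2 * int k + 1)) = 
      \<i> * of_real (2 * sin (2 * pi * (2 * real k + 1) / real p))"
      by (simp only: cnj_unity_char[symmetric]) (simp add: complex_eq_iff unity_char_def)
    finally show "unity_char p (2 * int k + 1) * (1 - unity_char p (-2) ^ (2*k+1)) =
      \<i> * of_real (2 * sin (2 * pi * (2 * real k + 1) / real p))" .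
  qed
  also have "\<dots> = \<i> ^ m * of_real (\<Prod>k<m. 2 * sin (2 * pi * (2 * real k + 1) / real p))"
    by (simp add: prod.distrib)
  finally show ?thesis .
qed

lemma sgn_prod: "sgn (\<Prod>k\<in>K. f k :: real) = (\<Prod>k\<in>K. sgn (f k))"
  by (induction K rule: infinite_finite_induct) (auto simp: sgn_mult)

text \<open>All angles lie strictly between 0 and \<open>2 * pi\<close>, so a factor is negative
  exactly when its angle exceeds \<open>pi\<close>.\<close>

lemma sgn_prod_sin_odd_multiples:
  assumes "p = 2 * m + 1"
  shows   "sgn (\<Prod>k<m. 2 * sin (2 * pi * (2 * real k + 1) / real p)) = (-1) ^ (m div 2)"
proof -
  let ?s = "\<lambda>k. 2 * sin (2 * pi * (2 * real k + 1) / real p)"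
  have p: "real p > 0" using assms by simp
  \<comment> \<open>This is \<open>m/2\<close> rounded up, the number of \<open>k\<close> with
    \<open>2 * (2 * k + 1) < p\<close>.\<close>
  define h where "h = m - m div 2"
  have "sgn (prod ?s {..<m}) = (\<Prod>k<m. sgn (?s k))"
    by (rule sgn_prod)
  also have "\<dots> = (\<Prod>k<m. if k < h then 1 else -1)"
  proof (intro prod.cong refl)
    fix k assume "k \<in> {..<m}"
    then have k: "k < m" by simp
    show "sgn (?s k) = (if k < h then 1 else -1)"
    proof (cases "k < h")
      case True
      then have "2 * (2 * k + 1) < p" unfolding h_def assms by presburger
      then have "real (2 * (2 * k + 1)) < real p" by (simp only: of_nat_less_iff)
      then have "pi * real (2 * (2 * k + 1)) < pi * real p" by (simp only: mult_less_cancel_left_pos pi_gt_zero)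
      then have "2 * pi * (2 * real k + 1) / real p < pi"
        using p by (simp add: divide_less_eq mult_ac)
      then have "sin (2 * pi * (2 * real k + 1) / real p) > 0"
        using p by (intro sin_gt_zero divide_pos_pos mult_pos_pos) auto
      then show ?thesis using True by simp
    next
      case False
      then have "p < 2 * (2 * k + 1)" using k unfolding h_def assms by presburger
      then have "real p < real (2 * (2 * k + 1))" by (simp only: of_nat_less_iff)
      then have "pi * real p < pi * real (2 * (2 * k + 1))" by (simp only: mult_less_cancel_left_pos pi_gt_zero)
      then have 1: "pi < 2 * pi * (2 * real k + 1) / real p"
        using p by (simp add: less_divide_eq mult_ac)
      have "2 * k + 1 < p" using k assms by simp
      then have "real (2 * k + 1) < real p" by (simp only: of_nat_less_iff)
      then have "pi * real (2 * k + 1) < pi * real p" by (simp only: mult_less_cancel_left_pos pi_gt_zero)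
      then have 2: "2 * pi * (2 * real k + 1) / real p < 2 * pi"
        using p by (simp add: divide_less_eq mult_ac)
      have "sin (2 * pi * (2 * real k + 1) / real p) < 0"
        using sin_lt_zero[OF 1 2] .
      then show ?thesis using False by simp
    qed
  qed
  also have "\<dots> = (-1) ^ card {h..<m}"
  proof -
    have "(\<Prod>k<m. if k < h then 1 else -1 :: real) = (\<Prod>k\<in>{h..<m}. -1)"
      by (rule prod.mono_neutral_cong_right) auto
    then show ?thesis by simp
  qed
  also have "card {h..<m} = m div 2" by (simp add: h_def)
  finally show ?thesis .
qed

theorem gauss_sum_eq:
  assumes "odd p"
  shows   "gauss_sum p = (if p mod 4 = 1 then 1 else \<i>) * complex_of_real (sqrt (real p))"
proof -
  obtain m where m: "p = 2 * m + 1" using assms by (blast elim: oddE)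
  define R where "R = (\<Prod>k<m. 2 * sin (2 * pi * (2 * real k + 1) / real p))"
  have S: "gauss_sum p = \<i> ^ m * of_real R"
    unfolding R_def by (rule gauss_sum_eq_prod_sin[OF m])
  \<comment> \<open>The power of \<open>\<i>\<close> has modulus 1, so the modulus of the Gauss sum
    fixes the real number \<open>R\<close> up to sign.\<close>
  have "R\<^sup>2 = real p"
    using norm_gauss_sum[OF assms] by (simp add: S norm_mult norm_power)
  then have "\<bar>R\<bar> = sqrt (real p)" by (metis real_sqrt_abs)
  then have "R = (-1) ^ (m div 2) * sqrt (real p)"
    using sgn_prod_sin_odd_multiples[OF m] by (metis R_def mult.commute abs_mult_sgn)
  \<comment> \<open>For \<open>m = 2t\<close> or \<open>m = 2t + 1\<close> the two factors
    \<open>(-1) ^ t\<close> cancel, leaving 1 or \<open>\<i>\<close>; \<open>m\<close> is even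
    exactly when \<open>p mod 4 = 1\<close>.\<close>
  moreover have "\<i> ^ m * (-1) ^ (m div 2) = (if p mod 4 = 1 then 1 else \<i>)"
  proof (cases "even m")
    case True
    then obtain t where t: "m = 2 * t" by blast
    then have "p mod 4 = 1" unfolding m by presburger
    then show ?thesis using t by (simp add: power_mult flip: power_mult_distrib)
  next
    case False
    then obtain t where t: "m = 2 * t + 1" by (blast elim: oddE)
    then have "p mod 4 \<noteq> 1" unfolding m by presburger
    then show ?thesis using t by (simp add: power_mult flip: power_mult_distrib)
  qed
  ultimately show ?thesis
    unfolding S by (simp flip: mult.assoc)
qed

section \<open>The prime field inside a field of characteristic p\<close>

text \<open>The parameter \<open>F\<close> carries the type of the ambient field.\<close>

locale odd_prime_char =
  fixes p :: nat and F :: "'a::field itself"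
  assumes prime_p: "prime p" and odd_p: "odd p" and CHAR_eq: "CHAR('a) = p"
begin

abbreviation K :: "'a set" where "K \<equiv> Fp p"

lemma p_gt_2: "p > 2"
  using prime_p odd_p prime_gt_1_nat[of p] by (cases "p = 2") auto

lemma p_pos: "p > 0"
  using p_gt_2 by simp

lemma of_nat_eq_iff_cong: "of_nat a = (of_nat b :: 'a) \<longleftrightarrow> [a = b] (mod p)"
  by (simp add: of_nat_eq_iff_cong_CHAR CHAR_eq)

lemma of_int_eq_iff_cong: "of_int a = (of_int b :: 'a) \<longleftrightarrow> [a = b] (mod int p)"
  by (simp add: of_int_eq_iff_cong_CHAR CHAR_eq)

lemma bij_betw_of_nat_Fp: "bij_betw of_nat {..<p} K"
  unfolding bij_betw_def Fp_def
  by (auto intro!: inj_onI simp: of_nat_eq_iff_cong cong_def)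

text \<open>Every integer is congruent modulo \<open>p\<close> to one of the representatives. The
  ring closure properties of \<open>K\<close> are then inherited from \<open>\<int>\<close>, and
  elements of \<open>K\<close> can be replaced by integers.\<close>

lemma Fp_eq_Ints: "K = \<int>"
  unfolding Ints_def
proof
  show "K \<subseteq> range of_int"
    unfolding Fp_def by (metis image_subsetI of_int_of_nat_eq rangeI)
  have "of_int k \<in> K" for k
  proof -
    have "of_int k = (of_int (k mod int p) :: 'a)"
      by (simp add: of_int_eq_iff_cong)
    also have "\<dots> = of_nat (nat (k mod int p))"
      using p_pos by (simp add: of_nat_nat)
    also have "\<dots> \<in> K"
      using p_pos unfolding Fp_def by (intro imageI) (simp add: nat_less_iff)
    finally show ?thesis .
  qed
  then show "range of_int \<subseteq> K" by auto
qed

lemma finite_Fp: "finite K"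
  by (simp add: Fp_def)

lemma card_Fp: "card K = p"
  using bij_betw_same_card[OF bij_betw_of_nat_Fp] by simp

lemma sum_Fp: "(\<Sum>y\<in>K. g y) = (\<Sum>k<p. g (of_nat k))"
  by (rule sum.reindex_bij_betw[OF bij_betw_of_nat_Fp, symmetric])

lemma Fp_0 [simp]: "0 \<in> K" and Fp_1 [simp]: "1 \<in> K"
  and Fp_add: "x \<in> K \<Longrightarrow> y \<in> K \<Longrightarrow> x + y \<in> K"
  and Fp_diff: "x \<in> K \<Longrightarrow> y \<in> K \<Longrightarrow> x - y \<in> K"
  and Fp_uminus: "x \<in> K \<Longrightarrow> - x \<in> K"
  and Fp_mult: "x \<in> K \<Longrightarrow> y \<in> K \<Longrightarrow> x * y \<in> K"
  by (simp_all add: Fp_eq_Ints)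

lemma Fp_numeral [simp]: "numeral m \<in> K"
  by (simp add: Fp_eq_Ints)

lemma Fp_power: "x \<in> K \<Longrightarrow> x ^ m \<in> K"
  by (induction m) (auto intro: Fp_mult)

lemma Fp_sum: "(\<And>i. i \<in> I \<Longrightarrow> g i \<in> K) \<Longrightarrow> sum g I \<in> K"
  by (induction I rule: infinite_finite_induct) (auto intro: Fp_add)

lemma Fp_prod: "(\<And>i. i \<in> I \<Longrightarrow> g i \<in> K) \<Longrightarrow> prod g I \<in> K"
  by (induction I rule: infinite_finite_induct) (auto intro: Fp_mult)

lemma Fp_power_minus_1_eq_1:
  assumes "x \<in> K" "x \<noteq> 0"
  shows   "x ^ (p - 1) = 1"
proof -
  obtain k where k: "x = of_nat k" using assms(1) unfolding Fp_def by auto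
  have "\<not> p dvd k"
    using assms(2) k by (metis CHAR_eq of_nat_eq_0_iff_char_dvd)
  then have "[k ^ (p - 1) = 1] (mod p)"
    by (rule fermat_theorem[OF prime_p])
  then show ?thesis
    unfolding k by (simp flip: of_nat_eq_iff_cong)
qed

lemma Fp_power_p: "x \<in> K \<Longrightarrow> x ^ p = x"
proof (cases "x = 0")
  case False
  assume "x \<in> K"
  then have "x ^ Suc (p - 1) = x"
    using False by (simp add: Fp_power_minus_1_eq_1 del: One_nat_def)
  then show ?thesis using p_pos by simp
qed (use p_pos in auto)

lemma Fp_power_p_power: "x \<in> K \<Longrightarrow> x ^ (p ^ i) = x"
  by (induction i) (auto simp: power_mult Fp_power_p)

lemma Fp_inverse: "x \<in> K \<Longrightarrow> inverse x \<in> K"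
proof (cases "x = 0")
  case False
  assume x: "x \<in> K"
  have "x * x ^ (p - 2) = x ^ Suc (p - 2)" by simp
  also have "Suc (p - 2) = p - 1" using p_gt_2 by simp
  also have "x ^ (p - 1) = 1" using Fp_power_minus_1_eq_1 x False by simp
  finally have "inverse x = x ^ (p - 2)" by (rule inverse_unique)
  then show ?thesis using Fp_power[OF x] by simp
qed auto

lemma Fp_divide: "x \<in> K \<Longrightarrow> y \<in> K \<Longrightarrow> x / y \<in> K"
  unfolding divide_inverse by (intro Fp_mult Fp_inverse)

text \<open>The polynomial \<open>X^p - X\<close> has at most \<open>p\<close> roots, and by Fermat
  \<open>K\<close> already supplies \<open>p\<close> of them.\<close>

lemma Fp_I_power_p:
  assumes "x ^ p = (x :: 'a)"
  shows   "x \<in> K"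
proof -
  define q :: "'a poly" where "q = monom 1 p - monom 1 1"
  have "coeff q p = 1" using p_gt_2 by (simp add: q_def)
  then have "q \<noteq> 0" by auto
  have root: "poly q y = 0 \<longleftrightarrow> y ^ p = y" for y by (simp add: q_def poly_monom)
  have deg: "degree q \<le> p"
    unfolding q_def using p_gt_2
    by (intro degree_diff_le) (auto intro: order.trans[OF degree_monom_le])
  have "K = {y. poly q y = 0}"
  proof (rule card_seteq)
    show "finite {y. poly q y = 0}" using \<open>q \<noteq> 0\<close> by (rule poly_roots_finite)
    show "K \<subseteq> {y. poly q y = 0}" by (auto simp: root Fp_power_p)
    show "card {y. poly q y = 0} \<le> card K"
      unfolding card_Fp using card_poly_roots_bound[OF \<open>q \<noteq> 0\<close>] deg by linarith
  qed
  then show ?thesis using assms by (simp add: root)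
qed

lemma two_neq_0: "(2 :: 'a) \<noteq> 0"
proof -
  have "\<not> p dvd 2" using p_gt_2 by (auto dest: dvd_imp_le)
  then show ?thesis
    by (metis CHAR_eq of_nat_eq_0_iff_char_dvd of_nat_numeral)
qed

section \<open>The additive character on the prime field\<close>

text \<open>The bridge from canonical representatives to arbitrary integers, through which
  \<open>epsp\<close> inherits additivity and orthogonality from \<open>unity_char\<close>.\<close>

lemma epsp_of_int: "epsp p (of_int k :: 'a) = unity_char p k"
proof -
  have "Fp_rep p (of_int k :: 'a) = nat (k mod int p)"
    unfolding Fp_rep_def
  proof (rule the_equality)
    have "(of_nat (nat (k mod int p)) :: 'a) = of_int (k mod int p)"
      using p_pos by (simp add: of_nat_nat)
    also have "\<dots> = of_int k" by (simp add: of_int_eq_iff_cong)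
    finally show "nat (k mod int p) < p \<and> of_nat (nat (k mod int p)) = (of_int k :: 'a)"
      using p_pos by (simp add: nat_less_iff)
  next
    fix j assume j: "j < p \<and> of_nat j = (of_int k :: 'a)"
    then have "[int j = k] (mod int p)"
      by (metis of_int_eq_iff_cong of_int_of_nat_eq)
    then show "j = nat (k mod int p)"
      using j by (simp add: cong_def)
  qed
  then have "epsp p (of_int k :: 'a) = unity_char p (k mod int p)"
    using p_pos by (simp add: epsp_def unity_char_def)
  also have "\<dots> = unity_char p k"
    by (rule unity_char_cong[OF _ p_pos]) simp
  finally show ?thesis .
qed

lemma epsp_of_nat: "epsp p (of_nat k :: 'a) = unity_char p (int k)"
  using epsp_of_int[of "int k"] by simp

lemma epsp_0: "epsp p (0 :: 'a) = 1"
  using epsp_of_int[of 0] by simp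

lemma epsp_add: "x \<in> K \<Longrightarrow> y \<in> K \<Longrightarrow> epsp p (x + y) = epsp p x * epsp p y"
  unfolding Fp_eq_Ints
  by (auto elim!: Ints_cases simp: epsp_of_int unity_char_add simp flip: of_int_add)

lemma epsp_sum: "(\<And>i. i \<in> I \<Longrightarrow> g i \<in> K) \<Longrightarrow> epsp p (sum g I) = (\<Prod>i\<in>I. epsp p (g i))"
  by (induction I rule: infinite_finite_induct) (auto simp: epsp_0 epsp_add Fp_sum)

lemma sum_epsp:
  assumes "c \<in> K"
  shows   "(\<Sum>y\<in>K. epsp p (c * y)) = (if c = 0 then of_nat p else 0)"
proof -
  obtain k where k: "c = of_int k" using assms unfolding Fp_eq_Ints by (rule Ints_cases)
  have "epsp p (c * of_nat j) = unity_char p (k * int j)" for j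
    using epsp_of_int[of "k * int j"] by (simp add: k)
  moreover have "c = 0 \<longleftrightarrow> int p dvd k"
    using of_int_eq_iff_cong[of k 0] by (simp add: k cong_0_iff)
  ultimately show ?thesis
    by (simp add: sum_Fp sum_unity_char[OF p_pos])
qed

section \<open>The quadratic character on the prime field\<close>

lemma of_nat_Fp_rep:
  assumes "y \<in> K"
  shows   "of_nat (Fp_rep p y) = y"
proof -
  have "\<exists>!k. k < p \<and> of_nat k = y"
    using assms by (auto simp: Fp_def of_nat_eq_iff_cong cong_def)
  from theI'[OF this] show ?thesis unfolding Fp_rep_def by blast
qed

text \<open>Euler's criterion read inside the field; multiplicativity of \<open>eta\<close> then
  comes from that of powers.\<close>

lemma of_int_eta:
  assumes "y \<in> K"
  shows   "of_int (eta p y) = y ^ ((p - 1) div 2)"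
proof -
  have "[eta p y = int (Fp_rep p y) ^ ((p - 1) div 2)] (mod int p)"
    unfolding eta_def by (rule euler_criterion[OF prime_p p_gt_2])
  then show ?thesis
    using of_nat_Fp_rep[OF assms] by (simp flip: of_int_eq_iff_cong)
qed

lemma eta_cases: "eta p y \<in> {-1, 0, 1}"
  by (auto simp: eta_def Legendre_def)

text \<open>Two numbers in {-1, 0, 1} differ by at most 2, hence by less than \<open>p\<close>, so
  equality in the field lifts to the integers.\<close>

lemma eta_eqI:
  assumes "of_int (eta p y) = (of_int e :: 'a)" "e \<in> {-1, 0, 1}"
  shows   "eta p y = e"
proof -
  have "int p dvd eta p y - e"
    using assms(1) by (simp add: of_int_eq_iff_cong cong_iff_dvd_diff)
  moreover have "\<bar>eta p y - e\<bar> < int p"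
    using assms(2) eta_cases[of y] p_gt_2 by auto
  ultimately show ?thesis
    using zdvd_not_zless[of "\<bar>eta p y - e\<bar>" "int p"] by (cases "eta p y = e") auto
qed

lemma eta_mult:
  assumes "x \<in> K" "y \<in> K"
  shows   "eta p (x * y) = eta p x * eta p y"
proof (rule eta_eqI)
  show "of_int (eta p (x * y)) = (of_int (eta p x * eta p y) :: 'a)"
    by (simp add: of_int_eta assms Fp_mult power_mult_distrib)
  show "eta p x * eta p y \<in> {-1, 0, 1}"
    using eta_cases[of x] eta_cases[of y] by auto
qed

lemma eta_1: "eta p (1 :: 'a) = 1"
  by (rule eta_eqI) (simp_all add: of_int_eta)

lemma eta_prod: "(\<And>i. i \<in> I \<Longrightarrow> g i \<in> K) \<Longrightarrow> eta p (prod g I) = (\<Prod>i\<in>I. eta p (g i))"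
  by (induction I rule: infinite_finite_induct) (auto simp: eta_1 eta_mult Fp_prod)

lemma eta_0: "eta p (0 :: 'a) = 0"
  by (rule eta_eqI) (use p_gt_2 in \<open>simp_all add: of_int_eta power_0_left\<close>)

lemma eta_square:
  assumes "z \<in> K" "z \<noteq> 0"
  shows   "eta p (z ^ 2) = 1"
proof (rule eta_eqI)
  have "2 * ((p - 1) div 2) = p - 1" using odd_p by simp
  then have "(z ^ 2) ^ ((p - 1) div 2) = z ^ (p - 1)" by (simp only: power_mult[symmetric])
  also have "\<dots> = 1" using assms by (rule Fp_power_minus_1_eq_1)
  finally show "of_int (eta p (z ^ 2)) = (of_int 1 :: 'a)"
    using assms by (simp only: of_int_eta Fp_power of_int_1)
qed auto

lemma eta_nonsquare:
  assumes "t \<in> K" "\<nexists>z. z \<in> K \<and> z ^ 2 = t"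
  shows   "eta p t = -1"
proof -
  have "t \<noteq> 0" using assms(2) by force
  let ?k = "int (Fp_rep p t)"
  have t: "of_int ?k = t" using of_nat_Fp_rep[OF assms(1)] by simp
  have "\<not> [?k = 0] (mod int p)"
    using t \<open>t \<noteq> 0\<close> by (metis of_int_0 of_int_eq_iff_cong)
  moreover have "\<not> QuadRes (int p) ?k"
  proof
    assume "QuadRes (int p) ?k"
    then obtain y where "[y ^ 2 = ?k] (mod int p)" unfolding QuadRes_def by blast
    then have "of_int y ^ 2 = t" using t by (metis of_int_eq_iff_cong of_int_power)
    then show False using assms(2) unfolding Fp_eq_Ints by (metis Ints_of_int)
  qed
  ultimately show ?thesis by (simp add: eta_def Legendre_def)
qed

lemma eta_eq_0_iff: "t \<in> K \<Longrightarrow> eta p t = 0 \<longleftrightarrow> t = 0"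
  using eta_0 of_int_eta[of t] by fastforce

section \<open>Exponential sums in one variable\<close>

text \<open>Serves to rewrite a sum over \<open>y\<close> of a function of \<open>y ^ 2\<close> as a
  sum over \<open>t\<close> with weight \<open>1 + eta p t\<close>.\<close>

lemma card_square_roots:
  assumes "t \<in> K"
  shows   "int (card {y\<in>K. y ^ 2 = t}) = 1 + eta p t"
proof (cases "\<exists>z. z \<in> K \<and> z ^ 2 = t")
  case False
  then have none: "{y\<in>K. y ^ 2 = t} = {}" by blast
  show ?thesis unfolding none eta_nonsquare[OF assms False] by simp
next
  case True
  then obtain z where z: "z \<in> K" "t = z ^ 2" by blast
  have roots: "{y\<in>K. y ^ 2 = t} = {z, -z}"
    using z Fp_uminus by (auto simp: power2_eq_iff)
  show ?thesis
  proof (cases "z = 0")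
    case True
    then have root: "{y\<in>K. y ^ 2 = t} = {0}" and t: "t = 0" using z roots by simp_all
    show ?thesis unfolding root by (simp add: t eta_0)
  next
    case False
    have "z \<noteq> -z"
    proof
      assume "z = -z"
      then have "2 * z = 0" unfolding eq_neg_iff_add_eq_0 mult_2 .
      then show False using False two_neq_0 by simp
    qed
    then have "card {y\<in>K. y ^ 2 = t} = 2" unfolding roots by simp
    then show ?thesis using eta_square[OF z(1) False] z(2) by simp
  qed
qed

text \<open>Grouping by the value of the square gives weights \<open>1 + eta p t\<close>. The
  constant part vanishes by orthogonality, and the substitution \<open>s = c * t\<close> extracts
  \<open>eta p c\<close>.\<close>

lemma sum_epsp_scaled_square:
  assumes d: "d \<in> K" "d \<noteq> 0"
  shows   "(\<Sum>y\<in>K. epsp p (d * y ^ 2)) = of_int (eta p d) * gauss_sum p"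
proof -
  define T where "T = (\<Sum>s\<in>K. of_int (eta p s) * epsp p s)"
  have *: "(\<Sum>y\<in>K. epsp p (c * y ^ 2)) = of_int (eta p c) * T" if c: "c \<in> K" "c \<noteq> 0" for c
  proof -
    have "(\<Sum>y\<in>K. epsp p (c * y ^ 2)) = (\<Sum>t\<in>K. \<Sum>y\<in>{y\<in>K. y ^ 2 = t}. epsp p (c * y ^ 2))"
      by (rule sum.group[symmetric]) (auto intro: Fp_power finite_Fp)
    also have "\<dots> = (\<Sum>t\<in>K. of_int (1 + eta p t) * epsp p (c * t))"
      by (intro sum.cong refl) (simp flip: card_square_roots)
    also have "\<dots> = (\<Sum>t\<in>K. of_int (eta p t) * epsp p (c * t))"
      using sum_epsp[OF c(1)] c(2) by (simp add: ring_distribs sum.distrib)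
    also have "\<dots> = (\<Sum>s\<in>K. of_int (eta p c) * (of_int (eta p s) * epsp p s))"
    proof (rule sum.reindex_bij_witness[of _ "\<lambda>s. s / c" "\<lambda>t. c * t"])
      fix t assume t: "t \<in> K"
      have "eta p c * eta p c = eta p (c ^ 2)" using c by (simp add: eta_mult power2_eq_square)
      also have "\<dots> = 1" using c by (rule eta_square)
      finally have "eta p c * eta p (c * t) = eta p t"
        using c t by (simp add: eta_mult flip: mult.assoc)
      then show "of_int (eta p c) * (of_int (eta p (c * t)) * epsp p (c * t)) =
                 of_int (eta p t) * epsp p (c * t)"
        by (simp flip: mult.assoc of_int_mult)
    qed (use c in \<open>auto intro: Fp_divide Fp_mult\<close>)
    finally show ?thesis by (simp add: T_def sum_distrib_left)
  qed
  \<comment> \<open>The case \<open>c = 1\<close> identifies the character sum \<open>T\<close> with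
    the Gauss sum.\<close>
  have "gauss_sum p = (\<Sum>y\<in>K. epsp p (1 * y ^ 2))"
    unfolding sum_Fp gauss_sum_def
    by (intro sum.cong refl) (simp flip: of_nat_power epsp_of_nat)
  also have "\<dots> = T" by (subst *) (auto simp: eta_1)
  finally show ?thesis using *[OF d] by simp
qed

lemma sum_epsp_quadratic:
  assumes "d \<in> K" "b \<in> K" "d \<noteq> 0"
  shows   "(\<Sum>y\<in>K. epsp p (d * y ^ 2 - b * y)) =
           of_int (eta p d) * gauss_sum p * epsp p (- (b ^ 2 / (4 * d)))"
proof -
  \<comment> \<open>The vertex of the parabola:
    \<open>d * y ^ 2 - b * y = d * (y - h) ^ 2 - d * h ^ 2\<close>.\<close>
  define h where "h = b / (2 * d)"
  have h: "h \<in> K" unfolding h_def using assms by (intro Fp_divide Fp_mult) auto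
  have e: "- (b ^ 2 / (4 * d)) = - (d * h ^ 2)" and b: "b = 2 * d * h"
    using assms(3) two_neq_0 by (simp_all add: h_def power2_eq_square field_simps)
  have "(\<Sum>y\<in>K. epsp p (d * y ^ 2 - b * y)) = (\<Sum>y\<in>K. epsp p (d * y ^ 2) * epsp p (- (d * h ^ 2)))"
  proof (rule sum.reindex_bij_witness[of _ "\<lambda>y. y + h" "\<lambda>y. y - h"])
    fix y assume y: "y \<in> K"
    have "d * y ^ 2 - b * y = d * (y - h) ^ 2 + - (d * h ^ 2)"
      by (simp add: b power2_eq_square algebra_simps)
    then show "epsp p (d * (y - h) ^ 2) * epsp p (- (d * h ^ 2)) = epsp p (d * y ^ 2 - b * y)"
      using y h assms by (simp only: epsp_add Fp_mult Fp_power Fp_diff Fp_uminus)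
  qed (use h in \<open>auto intro: Fp_add Fp_diff\<close>)
  also have "\<dots> = of_int (eta p d) * gauss_sum p * epsp p (- (d * h ^ 2))"
    using sum_epsp_scaled_square[OF assms(1,3)] by (simp flip: sum_distrib_right)
  finally show ?thesis unfolding e .
qed

section \<open>The absolute trace\<close>

text \<open>Raising to the power \<open>p\<close> permutes the summands of the trace cyclically, the
  hypothesis closing the cycle; the elements fixed by this map form \<open>K\<close>.\<close>

lemma Tr_in_Fp:
  assumes "x ^ (p ^ n) = (x :: 'a)"
  shows   "Tr p n x \<in> K"
proof (rule Fp_I_power_p)
  have "Tr p n x ^ p = (\<Sum>i<n. (x ^ (p ^ i)) ^ p)"
    unfolding Tr_def by (rule freshmans_dream_sum) (simp_all add: CHAR_eq prime_p)
  also have "\<dots> = (\<Sum>i<n. x ^ (p ^ Suc i))"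
    by (simp add: mult.commute flip: power_mult)
  also have "\<dots> = (\<Sum>i<Suc n. x ^ (p ^ i)) - x"
    unfolding sum.lessThan_Suc_shift[of _ n] by simp
  also have "\<dots> = Tr p n x"
    by (simp add: assms Tr_def)
  finally show "Tr p n x ^ p = Tr p n x" .
qed

lemma Tr_0: "Tr p n (0 :: 'a) = 0"
  using p_pos by (simp add: Tr_def power_0_left)

text \<open>The maps \<open>x ^ (p ^ k)\<close> are additive in characteristic \<open>p\<close> and
  fix every element of \<open>K\<close>.\<close>

lemma Tr_Fp_linear:
  assumes "\<And>i. i \<in> I \<Longrightarrow> c i \<in> K"
  shows   "Tr p n (\<Sum>i\<in>I. c i * g i) = (\<Sum>i\<in>I. c i * Tr p n (g i))"
proof -
  have "(\<Sum>i\<in>I. c i * g i) ^ (p ^ k) = (\<Sum>i\<in>I. c i * g i ^ (p ^ k))" for k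
  proof -
    have "(\<Sum>i\<in>I. c i * g i) ^ (p ^ k) = (\<Sum>i\<in>I. (c i * g i) ^ (p ^ k))"
      by (rule freshmans_dream_sum'[where n = k]) (simp_all add: CHAR_eq prime_p)
    also have "\<dots> = (\<Sum>i\<in>I. c i * g i ^ (p ^ k))"
      by (intro sum.cong refl) (simp add: power_mult_distrib Fp_power_p_power assms)
    finally show ?thesis .
  qed
  then have "Tr p n (\<Sum>i\<in>I. c i * g i) = (\<Sum>k<n. \<Sum>i\<in>I. c i * g i ^ (p ^ k))"
    by (simp add: Tr_def)
  also have "\<dots> = (\<Sum>i\<in>I. c i * Tr p n (g i))"
    by (subst sum.swap) (simp add: Tr_def sum_distrib_left)
  finally show ?thesis .
qed

text \<open>The exponent separates the variables, so the sum is a product of one-variable sums.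
  \<open>PiE\<close> makes each vector of coordinates over \<open>I\<close> occur exactly
  once.\<close>

lemma sum_epsp_diagonal:
  assumes "finite I" and d: "\<And>i. i \<in> I \<Longrightarrow> d i \<in> K" and b: "\<And>i. i \<in> I \<Longrightarrow> b i \<in> K"
  defines "N \<equiv> {i\<in>I. d i \<noteq> 0}"
  shows   "(\<Sum>y\<in>I \<rightarrow>\<^sub>E K. epsp p (\<Sum>i\<in>I. d i * y i ^ 2 - b i * y i)) =
           (if \<exists>i\<in>I - N. b i \<noteq> 0 then 0
            else of_nat p ^ card (I - N) * of_int (eta p (\<Prod>i\<in>N. d i)) * gauss_sum p ^ card N *
                 epsp p (\<Sum>i\<in>N. - (b i ^ 2 / (4 * d i))))"
proof -
  have N: "N \<subseteq> I" "finite N" using assms(1) unfolding N_def by auto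
  have inK: "- (b i ^ 2 / (4 * d i)) \<in> K" if "i \<in> N" for i
    using that d b N by (intro Fp_uminus Fp_divide Fp_mult Fp_power) auto
  have "(\<Sum>y\<in>I \<rightarrow>\<^sub>E K. epsp p (\<Sum>i\<in>I. d i * y i ^ 2 - b i * y i)) =
        (\<Sum>y\<in>I \<rightarrow>\<^sub>E K. \<Prod>i\<in>I. epsp p (d i * y i ^ 2 - b i * y i))"
    by (intro sum.cong refl epsp_sum Fp_diff Fp_mult Fp_power) (use d b in auto)
  also have "\<dots> = (\<Prod>i\<in>I. \<Sum>y\<in>K. epsp p (d i * y ^ 2 - b i * y))"
    by (rule prod_sum_PiE[symmetric]) (use assms(1) finite_Fp in auto)
  also have "\<dots> = (\<Prod>i\<in>I-N. \<Sum>y\<in>K. epsp p (d i * y ^ 2 - b i * y)) *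
                   (\<Prod>i\<in>N. \<Sum>y\<in>K. epsp p (d i * y ^ 2 - b i * y))"
    by (rule prod.subset_diff[OF N(1) assms(1)])
  \<comment> \<open>Outside \<open>N\<close> only the linear term remains, and orthogonality decides
    between \<open>p\<close> and 0.\<close>
  also have "(\<Prod>i\<in>I-N. \<Sum>y\<in>K. epsp p (d i * y ^ 2 - b i * y)) =
             (\<Prod>i\<in>I-N. if b i = 0 then of_nat p else 0)"
  proof (intro prod.cong refl)
    fix i assume "i \<in> I - N"
    then have "d i = 0" "- b i \<in> K" using b Fp_uminus by (auto simp: N_def)
    then show "(\<Sum>y\<in>K. epsp p (d i * y ^ 2 - b i * y)) = (if b i = 0 then of_nat p else 0)"
      using sum_epsp[of "- b i"] by simp
  qed
  also have "\<dots> = (if \<exists>i\<in>I - N. b i \<noteq> 0 then 0 else of_nat p ^ card (I - N))"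
    using assms(1) by (auto intro!: prod_zero)
  also have "(\<Prod>i\<in>N. \<Sum>y\<in>K. epsp p (d i * y ^ 2 - b i * y)) =
             (\<Prod>i\<in>N. of_int (eta p (d i)) * gauss_sum p * epsp p (- (b i ^ 2 / (4 * d i))))"
    by (intro prod.cong refl sum_epsp_quadratic) (use d b in \<open>auto simp: N_def\<close>)
  also have "\<dots> = of_int (eta p (\<Prod>i\<in>N. d i)) * gauss_sum p ^ card N *
                   epsp p (\<Sum>i\<in>N. - (b i ^ 2 / (4 * d i)))"
    using N d inK by (subst eta_prod) (auto simp: prod.distrib epsp_sum[OF inK] simp del: sum_negf)
  finally show ?thesis by (simp add: mult.assoc)
qed

end

section \<open>Walsh transforms of quadratic forms\<close>

lemma CHAR_eq_prime_if_card_eq_prime_power: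
  assumes "prime p" "card (UNIV :: 'a::{field,finite} set) = p ^ n"
  shows   "CHAR('a) = p"
proof -
  have "CHAR('a) > 0" by (rule finite_imp_CHAR_pos) simp
  then have "prime CHAR('a)" by (rule prime_CHAR_semidom)
  moreover have "CHAR('a) dvd p ^ n" using CHAR_dvd_CARD[where 'a = 'a] assms(2) by simp
  ultimately show ?thesis
    using assms(1) prime_dvd_power primes_dvd_imp_eq by blast
qed

text \<open>Multiplication by a nonzero \<open>x\<close> permutes the nonzero elements; comparing
  their products shows that the power with exponent one less than the order is 1.\<close>

lemma power_card_UNIV_eq:
  fixes x :: "'a::{field,finite}"
  shows "x ^ card (UNIV :: 'a set) = x"
proof (cases "x = 0")
  case False
  have "(\<Prod>y\<in>UNIV-{0}. y) = (\<Prod>y\<in>UNIV-{0}. x * y)"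
    by (rule prod.reindex_bij_witness[of _ "\<lambda>y. x * y" "\<lambda>y. y / x"]) (use False in auto)
  also have "\<dots> = x ^ (card (UNIV :: 'a set) - 1) * (\<Prod>y\<in>UNIV-{0}. y)"
    by (simp add: prod.distrib)
  finally have "x ^ (card (UNIV :: 'a set) - 1) = 1" by simp
  then have "x ^ Suc (card (UNIV :: 'a set) - 1) = x" by simp
  then show ?thesis using finite_UNIV_card_ge_0[where 'a = 'a] by simp
qed (use finite_UNIV_card_ge_0[where 'a = 'a] in auto)

section \<open>Linear changes of variables in quadratic forms\<close>

lemma det_nonzero_imp_kernel_trivial:
  fixes C :: "'a::field mat"
  assumes "C \<in> carrier_mat n n" "det C \<noteq> 0"
    and "\<And>i. i < n \<Longrightarrow> (\<Sum>j<n. C $$ (i,j) * v j) = 0" and "j < n"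
  shows   "v j = 0"
proof (rule ccontr)
  assume "v j \<noteq> 0"
  then have "vec n v \<noteq> 0\<^sub>v n" using assms(4) by (metis index_vec index_zero_vec(1))
  moreover have "C *\<^sub>v vec n v = 0\<^sub>v n"
    using assms(1,3) by (intro eq_vecI) (auto simp: scalar_prod_def atLeast0LessThan)
  ultimately show False
    using det_0_iff_vec_prod_zero_field[OF assms(1)] assms(2) by (metis vec_carrier)
qed

lemma congruence_mat_index:
  assumes "A \<in> carrier_mat n n" "C \<in> carrier_mat n n" "k < n" "l < n"
  shows   "(transpose_mat C * A * C) $$ (k,l) =
           (\<Sum>i<n. \<Sum>j<n. C $$ (i,k) * A $$ (i,j) * C $$ (j,l))"
proof -
  have "(transpose_mat C * A * C) $$ (k,l) = (\<Sum>i<n. C $$ (i,k) * (\<Sum>j<n. A $$ (i,j) * C $$ (j,l)))"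
    using assms by (simp add: scalar_prod_def atLeast0LessThan)
  then show ?thesis
    by (simp only: sum_distrib_left mult.assoc)
qed

text \<open>The substitution \<open>x = C y\<close> in \<open>x^T A x\<close>, written with
  coordinate functions.\<close>

lemma quadratic_form_congruence:
  fixes A C :: "'a::comm_ring_1 mat" and y :: "nat \<Rightarrow> 'a"
  assumes "A \<in> carrier_mat n n" "C \<in> carrier_mat n n"
  shows   "(\<Sum>i<n. \<Sum>j<n. (\<Sum>k<n. C $$ (i,k) * y k) * A $$ (i,j) * (\<Sum>l<n. C $$ (j,l) * y l)) =
           (\<Sum>k<n. \<Sum>l<n. y k * (transpose_mat C * A * C) $$ (k,l) * y l)"
proof -
  let ?g = "\<lambda>i j k l. y k * (C $$ (i,k) * A $$ (i,j) * C $$ (j,l)) * y l"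
  have "(\<Sum>i<n. \<Sum>j<n. (\<Sum>k<n. C $$ (i,k) * y k) * A $$ (i,j) * (\<Sum>l<n. C $$ (j,l) * y l)) =
        (\<Sum>i<n. \<Sum>j<n. \<Sum>k<n. \<Sum>l<n. ?g i j k l)"
  proof (intro sum.cong refl)
    fix i j
    show "(\<Sum>k<n. C $$ (i,k) * y k) * A $$ (i,j) * (\<Sum>l<n. C $$ (j,l) * y l) =
          (\<Sum>k<n. \<Sum>l<n. ?g i j k l)"
      by (subst sum_distrib_right, subst sum_product) (simp add: mult_ac)
  qed
  \<comment> \<open>Four adjacent swaps carry \<open>k\<close> and \<open>l\<close> outside
    \<open>i\<close> and \<open>j\<close>, so that the inner double sum is an entry of the congruent
    matrix.\<close>
  also have "\<dots> = (\<Sum>i<n. \<Sum>k<n. \<Sum>j<n. \<Sum>l<n. ?g i j k l)"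
    by (intro sum.cong refl sum.swap)
  also have "\<dots> = (\<Sum>k<n. \<Sum>i<n. \<Sum>j<n. \<Sum>l<n. ?g i j k l)"
    by (rule sum.swap)
  also have "\<dots> = (\<Sum>k<n. \<Sum>i<n. \<Sum>l<n. \<Sum>j<n. ?g i j k l)"
    by (intro sum.cong refl sum.swap)
  also have "\<dots> = (\<Sum>k<n. \<Sum>l<n. \<Sum>i<n. \<Sum>j<n. ?g i j k l)"
    by (intro sum.cong refl sum.swap)
  also have "\<dots> = (\<Sum>k<n. \<Sum>l<n. y k * (transpose_mat C * A * C) $$ (k,l) * y l)"
  proof (intro sum.cong refl)
    fix k l assume "k \<in> {..<n}" "l \<in> {..<n}"
    then show "(\<Sum>i<n. \<Sum>j<n. ?g i j k l) = y k * (transpose_mat C * A * C) $$ (k,l) * y l"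
      using congruence_mat_index[OF assms, of k l]
      by (simp only: sum_distrib_left sum_distrib_right lessThan_iff)
  qed
  finally show ?thesis .
qed

lemma diagonal_quadratic_form:
  fixes D :: "'a::comm_ring_1 mat"
  assumes "D \<in> carrier_mat n n" "diagonal_mat D"
  shows   "(\<Sum>k<n. \<Sum>l<n. y k * D $$ (k,l) * y l) = (\<Sum>k<n. D $$ (k,k) * y k ^ 2)"
proof (intro sum.cong refl)
  fix k assume "k \<in> {..<n}"
  then have k: "k < n" by simp
  have "(\<Sum>l<n. y k * D $$ (k,l) * y l) = (\<Sum>l<n. if l = k then D $$ (k,k) * y k ^ 2 else 0)"
    using assms k unfolding diagonal_mat_def
    by (intro sum.cong refl) (auto simp: power2_eq_square mult_ac)
  then show "(\<Sum>l<n. y k * D $$ (k,l) * y l) = D $$ (k,k) * y k ^ 2"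
    using k by simp
qed

text \<open>The factor \<open>p\<close> comes from the one zero diagonal entry. It counts as two
  factors \<open>sqrt p\<close>, which raises the exponent from \<open>n - 1\<close> to
  \<open>n + 1\<close>; the rest is a power of \<open>\<i>\<close> split by the parity of
  \<open>n\<close>.\<close>

lemma gauss_sum_power_times_p:
  assumes "odd p" "n \<ge> 2"
  shows   "of_nat p * gauss_sum p ^ (n - 1) =
           (if p mod 4 = 1 then 1
            else if even n then (-1) ^ ((n - 2) div 2) * \<i>
            else (-1) ^ ((n - 1) div 2)) * complex_of_real (sqrt (real p) ^ (n + 1))"
proof -
  have "of_nat p = complex_of_real (sqrt (real p)) ^ 2"
    by (simp flip: of_real_power)
  then have "of_nat p * gauss_sum p ^ (n - 1) =
             (if p mod 4 = 1 then 1 else \<i>) ^ (n - 1) * complex_of_real (sqrt (real p)) ^ (2 + (n - 1))"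
    by (simp only: gauss_sum_eq[OF assms(1)] power_mult_distrib power_add mult_ac)
  also have "2 + (n - 1) = n + 1" using assms(2) by simp
  also have "(if p mod 4 = 1 then 1 else \<i>) ^ (n - 1) =
     (if p mod 4 = 1 then 1
      else if even n then (-1) ^ ((n - 2) div 2) * \<i>
      else (-1) ^ ((n - 1) div 2))"
  proof (cases "even n")
    case True
    then obtain t where "n = 2 * t" by blast
    \<comment> \<open>Since \<open>n \<ge> 2\<close> forces \<open>t \<ge> 1\<close>, the natural
      number subtractions are exact.\<close>
    then have "n - 1 = Suc (2 * (t - 1))" "(n - 2) div 2 = t - 1" using assms(2) by auto
    then show ?thesis using True by (simp add: power_mult del: One_nat_def)
  next
    case False
    then obtain t where "n = 2 * t + 1" by (blast elim: oddE)
    then have "n - 1 = 2 * t" "(n - 1) div 2 = t" by auto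
    then show ?thesis using False by (simp add: power_mult del: One_nat_def)
  qed
  finally show ?thesis by simp
qed

theorem theorem6:
  fixes p n :: nat and f :: "'a::{field,finite} \<Rightarrow> 'a"
    and \<alpha> :: "nat \<Rightarrow> 'a" and A C :: "'a mat"
  assumes "prime p" and "odd p" and "n \<ge> 2"
    and "card (UNIV :: 'a set) = p ^ n"
    and "\<forall>x. f x \<in> Fp p"
    and "quadratic_fun p n f" and "near_bent p n f"
    and "is_Fp_basis p n \<alpha>"
    and "A \<in> carrier_mat n n" and "mat_over_Fp p A" and "transpose_mat A = A"
    and "\<forall>c. (\<forall>i<n. c i \<in> Fp p) \<longrightarrow>
            f (\<Sum>i<n. c i * \<alpha> i) = (\<Sum>i<n. \<Sum>j<n. c i * A $$ (i,j) * c j)"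
    and "C \<in> carrier_mat n n" and "mat_over_Fp p C" and "det C \<noteq> 0"
    and "diagonal_mat (transpose_mat C * A * C)"
  shows "let D = transpose_mat C * A * C;
             \<Delta> = (\<Prod>i\<in>{i. i < n \<and> D $$ (i,i) \<noteq> 0}. D $$ (i,i));
             \<kappa> = (if p mod 4 = 1 then of_int (eta p \<Delta>)
                  else if even n then (-1) ^ ((n - 2) div 2) * of_int (eta p \<Delta>) * \<i>
                  else (-1) ^ ((n - 1) div 2) * of_int (eta p \<Delta>))
         in card {i. i < n \<and> D $$ (i,i) \<noteq> 0} = n - 1 \<and>
            (\<exists>J :: 'a \<Rightarrow> 'a. (\<forall>b\<in>supp_walsh p n f. J b \<in> Fp p) \<and>
               (\<forall>b. walsh p n f b = 0 \<or>
                    walsh p n f b = \<kappa> * complex_of_real (sqrt (real p) ^ (n + 1)) * epsp p (J b)))"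
proof -
  interpret odd_prime_char p "TYPE('a)"
    by unfold_locales (use assms CHAR_eq_prime_if_card_eq_prime_power in auto)

  define D where "D = transpose_mat C * A * C"
  define d where "d = (\<lambda>i. D $$ (i,i))"
  define N where "N = {i\<in>{..<n}. d i \<noteq> 0}"
  define \<Delta> where "\<Delta> = (\<Prod>i\<in>N. d i)"
  \<comment> \<open>\<open>\<beta> b\<close> holds the coefficients of the linear form
    \<open>Tr p n (b * point y)\<close> in the diagonalizing coordinates \<open>y\<close>;
    \<open>J\<close> collects the constants left by completing the squares.\<close>
  define \<beta> where "\<beta> = (\<lambda>b j. \<Sum>i<n. C $$ (i,j) * Tr p n (b * \<alpha> i))"
  define J where "J = (\<lambda>b. \<Sum>i\<in>N. - (\<beta> b i ^ 2 / (4 * d i)))"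
  define coeffs where "coeffs = (\<lambda>y i. \<Sum>j<n. C $$ (i,j) * y j)"
  define point where "point = (\<lambda>y. \<Sum>i<n. coeffs y i * \<alpha> i)"
  let ?Y = "{..<n} \<rightarrow>\<^sub>E K"

  have A_K: "A $$ (i,j) \<in> K" and C_K: "C $$ (i,j) \<in> K" if "i < n" "j < n" for i j
    using that assms(9,10,13,14) by (auto simp: mat_over_Fp_def)
  have Tr_K: "Tr p n x \<in> K" for x :: 'a
    using power_card_UNIV_eq[of x] assms(4) by (intro Tr_in_Fp) simp
  have d_K: "d i \<in> K" if "i \<in> {..<n}" for i
    using that unfolding d_def D_def
    by (subst congruence_mat_index[OF assms(9,13)]) (auto intro!: Fp_sum Fp_mult A_K C_K)
  have \<beta>_K: "\<beta> b i \<in> K" if "i \<in> {..<n}" for b i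
    using that unfolding \<beta>_def by (auto intro!: Fp_sum Fp_mult C_K Tr_K)
  have N: "N \<subseteq> {..<n}" "finite N" by (auto simp: N_def)
  have J_K: "J b \<in> K" for b
    unfolding J_def using N by (intro Fp_sum Fp_uminus Fp_divide Fp_power Fp_mult \<beta>_K d_K) auto
  have coeffs_K: "coeffs y i \<in> K" if "y \<in> ?Y" "i < n" for y i
    using that unfolding coeffs_def by (auto intro!: Fp_sum Fp_mult C_K)

  \<comment> \<open>Uniqueness of basis coordinates recovers \<open>C y\<close> from the point, and
    nonsingularity of \<open>C\<close> then recovers \<open>y\<close>.\<close>
  have "inj_on point ?Y"
  proof (rule inj_onI)
    fix y z assume yz: "y \<in> ?Y" "z \<in> ?Y" "point y = point z"
    \<comment> \<open>The coordinates are padded with 0 because \<open>is_Fp_basis\<close> asserts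
      uniqueness among functions vanishing from \<open>n\<close> on.\<close>
    let ?c = "\<lambda>y i. if i < n then coeffs y i else 0"
    define P where "P = (\<lambda>c. (\<forall>i<n. c i \<in> K) \<and> (\<forall>i\<ge>n. c i = 0) \<and> point z = (\<Sum>i<n. c i * \<alpha> i))"
    have P: "P (?c u)" if "u \<in> ?Y" "point u = point z" for u
      using that by (auto simp: P_def coeffs_K point_def)
    have "\<exists>!c. P c"
      using assms(8) unfolding is_Fp_basis_def P_def by (rule spec)
    then have "?c y = ?c z"
      using P[OF yz(1,3)] P[OF yz(2) refl] by blast
    then have "coeffs y i = coeffs z i" if "i < n" for i
      using that fun_cong[of "?c y" "?c z" i] by simp
    then have "(\<Sum>j<n. C $$ (i,j) * (y j - z j)) = 0" if "i < n" for i
      using that by (simp add: coeffs_def right_diff_distrib sum_subtractf)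
    from det_nonzero_imp_kernel_trivial[OF assms(13,15) this]
    have "y j = z j" if "j < n" for j using that by simp
    then show "y = z" using yz(1,2) by (intro PiE_ext[of y _ _ z]) auto
  qed
  \<comment> \<open>Both sets have \<open>p ^ n\<close> elements, so injectivity gives
    surjectivity.\<close>
  moreover have "card ?Y = card (UNIV :: 'a set)"
    using assms(4) by (simp add: card_PiE card_Fp)
  ultimately have "point ` ?Y = UNIV"
    by (intro card_subset_eq) (auto simp: card_image)
  with \<open>inj_on point ?Y\<close> have bij: "bij_betw point ?Y UNIV"
    by (simp add: bij_betw_def)

  have f_point: "f (point y) = (\<Sum>k<n. d k * y k ^ 2)" if "y \<in> ?Y" for y
  proof -
    have "f (point y) = (\<Sum>i<n. \<Sum>j<n. coeffs y i * A $$ (i,j) * coeffs y j)"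
      unfolding point_def using assms(12) coeffs_K[OF that] by blast
    also have "\<dots> = (\<Sum>k<n. d k * y k ^ 2)"
      unfolding coeffs_def quadratic_form_congruence[OF assms(9,13)] d_def D_def
      using assms(9,13,16) by (intro diagonal_quadratic_form) auto
    finally show ?thesis .
  qed
  have Tr_point: "Tr p n (b * point y) = (\<Sum>j<n. \<beta> b j * y j)" if "y \<in> ?Y" for b y
  proof -
    have "Tr p n (b * point y) = Tr p n (\<Sum>i<n. coeffs y i * (b * \<alpha> i))"
      by (simp add: point_def sum_distrib_left mult_ac)
    also have "\<dots> = (\<Sum>i<n. coeffs y i * Tr p n (b * \<alpha> i))"
      using coeffs_K[OF that] by (intro Tr_Fp_linear) auto
    also have "\<dots> = (\<Sum>i<n. \<Sum>j<n. C $$ (i,j) * Tr p n (b * \<alpha> i) * y j)"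
      unfolding coeffs_def sum_distrib_right by (simp only: mult_ac)
    also have "\<dots> = (\<Sum>j<n. \<beta> b j * y j)"
      unfolding \<beta>_def sum_distrib_right by (rule sum.swap)
    finally show ?thesis .
  qed

  \<comment> \<open>Summing over \<open>y\<close> instead of field elements turns the Walsh
    transform into a diagonal exponential sum.\<close>
  have walsh_eq: "walsh p n f b =
      (if \<exists>i\<in>{..<n} - N. \<beta> b i \<noteq> 0 then 0
       else of_nat p ^ card ({..<n} - N) * of_int (eta p \<Delta>) * gauss_sum p ^ card N * epsp p (J b))"
    for b
  proof -
    have "walsh p n f b = (\<Sum>y\<in>?Y. epsp p (f (point y) - Tr p n (b * point y)))"
      unfolding walsh_def by (rule sum.reindex_bij_betw[OF bij, symmetric])
    also have "\<dots> = (\<Sum>y\<in>?Y. epsp p (\<Sum>i<n. d i * y i ^ 2 - \<beta> b i * y i))"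
      by (intro sum.cong refl) (simp add: f_point Tr_point sum_subtractf)
    finally show ?thesis
      unfolding N_def \<Delta>_def J_def by (simp only: sum_epsp_diagonal[OF finite_lessThan d_K \<beta>_K])
  qed

  have "\<Delta> \<noteq> 0" "\<Delta> \<in> K"
    using N d_K unfolding \<Delta>_def by (auto simp: N_def intro!: Fp_prod)
  then have "eta p \<Delta> \<noteq> 0" by (simp add: eta_eq_0_iff)
  \<comment> \<open>Being 1 or -1, this character value does not affect the modulus of a Walsh
    value.\<close>
  then have eta_\<Delta>: "(of_int (eta p \<Delta>) :: real) ^ 2 = 1"
    using eta_cases[of \<Delta>] by auto
  have card_diff: "card ({..<n} - N) = n - card N" and card_le: "card N \<le> n"
    using N card_mono[of "{..<n}" N] by (auto simp: card_Diff_subset)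
  have card_N: "card N = n - 1"
  proof -
    \<comment> \<open>With no linear terms, each zero diagonal entry contributes \<open>p^2\<close>
      and each nonzero one \<open>p\<close> to the squared modulus. The total
      \<open>p ^ (2 * n - card N)\<close> is nonzero, so near-bentness makes the exponent
      \<open>n + 1\<close>.\<close>
    have "\<beta> 0 i = 0" for i by (simp add: \<beta>_def Tr_0)
    then have W0: "walsh p n f 0 =
        of_nat p ^ (n - card N) * of_int (eta p \<Delta>) * gauss_sum p ^ card N * epsp p (J 0)"
      by (simp add: walsh_eq card_diff)
    have "cmod (walsh p n f 0) ^ 2 =
          (real p ^ 2) ^ (n - card N) * (of_int (eta p \<Delta>)) ^ 2 * (cmod (gauss_sum p) ^ 2) ^ card N"
      unfolding W0 by (simp add: norm_mult norm_power power_mult_distrib epsp_def mult.commute flip: power_mult)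
    also have "\<dots> = real p ^ (2 * (n - card N) + card N)"
      unfolding norm_gauss_sum[OF odd_p] eta_\<Delta> by (simp add: power_add power_mult)
    also have "2 * (n - card N) + card N = 2 * n - card N" using card_le by simp
    finally have "cmod (walsh p n f 0) ^ 2 = real p ^ (2 * n - card N)" .
    moreover have "real p ^ (2 * n - card N) \<noteq> 0" using p_pos by simp
    ultimately have "real p ^ (2 * n - card N) = real p ^ (n + 1)"
      using assms(7) unfolding near_bent_def by (metis insertE singletonD)
    then have "2 * n - card N = n + 1"
      using p_gt_2 by (subst (asm) power_inject_exp) auto
    then show ?thesis using card_le by simp
  qed

  define \<kappa> :: complex where "\<kappa> = (if p mod 4 = 1 then of_int (eta p \<Delta>)
                  else if even n then (-1) ^ ((n - 2) div 2) * of_int (eta p \<Delta>) * \<i>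
                  else (-1) ^ ((n - 1) div 2) * of_int (eta p \<Delta>))"
  have \<kappa>: "of_int (eta p \<Delta>) * (of_nat p * gauss_sum p ^ (n - 1)) =
           \<kappa> * complex_of_real (sqrt (real p) ^ (n + 1))"
    unfolding gauss_sum_power_times_p[OF assms(2,3)] \<kappa>_def by simp
  \<comment> \<open>The single zero diagonal entry supplies the one factor \<open>p\<close> next to
    the Gauss sums.\<close>
  have "card ({..<n} - N) = 1" using card_N card_diff assms(3) by simp
  then have "walsh p n f b = 0 \<or>
      walsh p n f b = of_int (eta p \<Delta>) * (of_nat p * gauss_sum p ^ (n - 1)) * epsp p (J b)" for b
    unfolding walsh_eq card_N by (simp add: mult_ac)
  note walsh_cases = this[unfolded \<kappa>]
  have N_eq: "{i. i < n \<and> D $$ (i,i) \<noteq> 0} = N" and \<Delta>_eq: "(\<Prod>i\<in>N. D $$ (i,i)) = \<Delta>"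
    by (auto simp: N_def \<Delta>_def d_def)
  show ?thesis
    unfolding D_def[symmetric] Let_def N_eq \<Delta>_eq \<kappa>_def[symmetric]
    using card_N J_K walsh_cases by blast
qed

end
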